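(* Let $a\neq c$ be positive real constants with $a+c\le 1$, and let $W^{(1)}$ be the $N\times N$ weight matrix associated with the $1$-dimensional lattice of $N$ nodes with weights $W_{i,i+1}=c$ and $W_{i+1,i}=a$ for $i\in\{1,\dots,N-1\}$. Then the eigenvalues of $W^{(1)}$ are $$\lambda_1=1,\qquad \lambda_\ell = 1-a-c+2\sqrt{ac}\,\cos\frac{(\ell-1)\pi}{N},\quad \ell\in\{2,\dots,N\},$$ and its left Perron vector is $$\pi=\frac{1-c/a}{1-(c/a)^N}\,\bigl[\,1,\ c/a,\ (c/a)^2,\ \dots,\ (c/a)^{N-1}\bigr].$$
   Context: The $1$-dimensional lattice has nodes $1,\dots,N$, with $i$ and $i+1$ neighbors for $1\le i\le N-1$. The weight matrix $W^{(1)}$ is the tridiagonal matrix with the given off-diagonal entries and with diagonal entries determined by stochasticity ($W\mathbf 1=\mathbf 1$, $\mathbf 1$ the all-ones vector): $W_{1,1}=1-c$, $W_{i,i}=1-a-c$ for $2\le i\le N-1$, and $W_{N,N}=1-a$. The left Perron vector of a stochastic, irreducible, primitive matrix $W$ is the row vector $\pi\in\mathbb{R}^{1\times N}$ with $\pi W=\pi$, $\pi_i>0$ for all $i$, and $\sum_{i=1}^N\pi_i=1$. (In the eigenvalue formula, $\pi$ denotes the usual number.) *)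

theory Defs
  imports "Jordan_Normal_Form.Spectral_Radius"
begin

text \<open>Matrices are indexed from 0: node \<open>i\<close> of the lattice is row and column \<open>i - 1\<close>.
  The diagonal entry is 1 minus the off-diagonal entries of its row, so it is \<open>1 - c\<close> in the first
  row, \<open>1 - a\<close> in the last row and \<open>1 - a - c\<close> in between. A single node gives the matrix \<open>[1]\<close>.\<close>

definition lattice_mat :: "real \<Rightarrow> real \<Rightarrow> nat \<Rightarrow> real mat" where
  "lattice_mat a c N = mat N N (\<lambda>(i, j).
     if j = i + 1 then c
     else if i = j + 1 then a
     else if i = j then 1 - (if 0 < i then a else 0) - (if i + 1 < N then c else 0)
     else 0)"

definition lattice_eigval :: "real \<Rightarrow> real \<Rightarrow> nat \<Rightarrow> nat \<Rightarrow> real" where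
  "lattice_eigval a c N l =
     (if l = 1 then 1 else 1 - a - c + 2 * sqrt (a * c) * cos ((real l - 1) * pi / real N))"

definition stochastic_mat :: "real mat \<Rightarrow> bool" where
  "stochastic_mat W \<longleftrightarrow> square_mat W \<and>
     (\<forall>i < dim_row W. \<forall>j < dim_col W. 0 \<le> W $$ (i, j)) \<and>
     (\<forall>i < dim_row W. (\<Sum>j < dim_col W. W $$ (i, j)) = 1)"

text \<open>For a nonnegative matrix, \<open>(W ^ k) $$ (i, j) > 0\<close> says that the digraph of \<open>W\<close>
  has a walk of length \<open>k\<close> from \<open>i\<close> to \<open>j\<close>.\<close>

definition irreducible_mat :: "real mat \<Rightarrow> bool" where
  "irreducible_mat W \<longleftrightarrow>
     (\<forall>i < dim_row W. \<forall>j < dim_row W. \<exists>k. 0 < (W ^\<^sub>m k) $$ (i, j))"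

definition primitive_mat :: "real mat \<Rightarrow> bool" where
  "primitive_mat W \<longleftrightarrow>
     (\<exists>k > 0. \<forall>i < dim_row W. \<forall>j < dim_row W. 0 < (W ^\<^sub>m k) $$ (i, j))"

definition left_perron_vector :: "real mat \<Rightarrow> real mat \<Rightarrow> bool" where
  "left_perron_vector W p \<longleftrightarrow>
     stochastic_mat W \<and> irreducible_mat W \<and> primitive_mat W \<and>
     p \<in> carrier_mat 1 (dim_row W) \<and> p * W = p \<and>
     (\<forall>i < dim_row W. 0 < p $$ (0, i)) \<and> (\<Sum>i < dim_row W. p $$ (0, i)) = 1"

end

theory Submission
  imports Defs
begin

text \<open>
  Think of \<open>W\<close> as a random walk on a path that is reflected at both ends by staying put. Applied to
  a column \<open>v\<close>, the matrix produces \<open>v\<^sub>i + c (v\<^sub>i\<^sub>+\<^sub>1 - v\<^sub>i) - a (v\<^sub>i - v\<^sub>i\<^sub>-\<^sub>1)\<close>, where the terms that would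
  leave the path are dropped. So the eigenvalue equation is a linear recurrence with constant
  coefficients for a sequence that is extended by the Neumann conditions \<open>v\<^sub>-\<^sub>1 = v\<^sub>0\<close> and
  \<open>v\<^sub>N = v\<^sub>N\<^sub>-\<^sub>1\<close>. With \<open>r = sqrt (a / c)\<close>, substituting \<open>v\<^sub>i = r\<^sup>i u\<^sub>i\<close> symmetrises the recurrence to
  \<open>u\<^sub>i\<^sub>-\<^sub>1 + u\<^sub>i\<^sub>+\<^sub>1 = 2 cos \<theta> u\<^sub>i\<close> with eigenvalue \<open>1 - a - c + 2 sqrt (a c) cos \<theta>\<close>. The condition at
  the left end selects \<open>u\<^sub>i = sin ((i + 1) \<theta>) - r sin (i \<theta>)\<close>, and the one at the right end then
  holds as soon as \<open>sin (N \<theta>) = 0\<close>. This gives \<open>N - 1\<close> eigenvalues for \<open>\<theta> = k \<pi> / N\<close>,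
  \<open>0 < k < N\<close> (lemma \<open>lattice_mode\<close>); the constant column gives the eigenvalue 1.

  The cosine is injective on these angles, and by the arithmetic-geometric mean inequality, strict
  because of \<open>a \<noteq> c\<close>, all the cosine eigenvalues are less than 1. Together with 1 they are \<open>N\<close>
  distinct roots of the monic characteristic polynomial of degree \<open>N\<close>, which is thereby determined, and no further
  eigenvalue exists, real or complex.

  For a row \<open>p\<close>, the equation \<open>p W = p\<close> says that the net flow \<open>c p\<^sub>i - a p\<^sub>i\<^sub>+\<^sub>1\<close> across an edge is
  the same for neighbouring edges, and that it vanishes at the ends. Hence every flow is zero, which is
  detailed balance: \<open>p\<close> is geometric with ratio \<open>c / a\<close>, and the normalisation fixes it. Finally,
  every two nodes are joined by walks of the common length \<open>2 N\<close>, because a walk can go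
  to the first node, idle there, and go on; so the matrix is irreducible and primitive.
\<close>

section \<open>The action of the lattice matrix on columns and rows\<close>

lemma sum_tridiagonal:
  fixes f g h :: "nat \<Rightarrow> 'a :: comm_monoid_add"
  assumes "i < N"
  shows "(\<Sum>k<N. if k = i + 1 then f k else if i = k + 1 then g k else if i = k then h k else 0)
    = (if i + 1 < N then f (i + 1) else 0) + (if 0 < i then g (i - 1) else 0) + h i"
proof -
  have "(\<Sum>k<N. if k = i + 1 then f k else if i = k + 1 then g k else if i = k then h k else 0)
     = (\<Sum>k<N. (if i + 1 = k then f k else 0) + (if i - 1 = k then (if 0 < i then g k else 0) else 0)
          + (if i = k then h k else 0))"
    by (rule sum.cong) auto
  moreover have "i - 1 < N"
    using assms by simp
  ultimately show ?thesis
    using assms by (simp add: sum.distrib)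
qed

lemma lattice_mat_carrier [simp]: "lattice_mat a c N \<in> carrier_mat N N"
  and lattice_mat_dim [simp]:
    "dim_row (lattice_mat a c N) = N" "dim_col (lattice_mat a c N) = N"
  by (simp_all add: lattice_mat_def)

text \<open>Row stochasticity turns the diagonal entry into differences of neighbouring values, so that a
  missing neighbour just drops its difference, as if the value beyond the end repeated the last one.
  In a column sum the same entry pairs the terms into net flows across the two adjacent edges.\<close>

lemma lattice_mat_row_sum:
  assumes "i < N"
  shows "(\<Sum>j<N. lattice_mat a c N $$ (i, j) * v j)
    = v i + (if i + 1 < N then c * (v (i + 1) - v i) else 0)
          - (if 0 < i then a * (v i - v (i - 1)) else 0)"
proof -
  have "(\<Sum>j<N. lattice_mat a c N $$ (i, j) * v j)
    = (\<Sum>j<N. if j = i + 1 then c * v j else if i = j + 1 then a * v j else if i = j then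
        (1 - (if 0 < i then a else 0) - (if i + 1 < N then c else 0)) * v j else 0)"
    using assms by (intro sum.cong) (auto simp: lattice_mat_def)
  then show ?thesis
    using assms by (simp only: sum_tridiagonal) (simp add: algebra_simps)
qed

lemma lattice_mat_column_sum:
  assumes "j < N"
  shows "(\<Sum>i<N. p i * lattice_mat a c N $$ (i, j))
    = p j - (if j + 1 < N then c * p j - a * p (j + 1) else 0)
          + (if 0 < j then c * p (j - 1) - a * p j else 0)"
proof -
  have "(\<Sum>i<N. p i * lattice_mat a c N $$ (i, j))
    = (\<Sum>i<N. if i = j + 1 then p i * a else if j = i + 1 then p i * c else if j = i then
        p i * (1 - (if 0 < j then a else 0) - (if j + 1 < N then c else 0)) else 0)"
    using assms by (intro sum.cong) (auto simp: lattice_mat_def)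
  then show ?thesis
    using assms by (simp only: sum_tridiagonal) (simp add: algebra_simps)
qed

section \<open>Eigenvalues\<close>

lemma eigenvalueI_sum:
  fixes A :: "'a :: comm_ring_1 mat"
  assumes A: "A \<in> carrier_mat n n"
    and eq: "\<And>i. i < n \<Longrightarrow> (\<Sum>j<n. A $$ (i, j) * v j) = k * v i"
    and nz: "m < n" "v m \<noteq> 0"
  shows "eigenvalue A k"
proof -
  have "vec n v \<noteq> 0\<^sub>v n"
    using nz by (metis index_vec index_zero_vec(1))
  moreover have "A *\<^sub>v vec n v = k \<cdot>\<^sub>v vec n v"
  proof (rule eq_vecI)
    fix i assume i: "i < dim_vec (k \<cdot>\<^sub>v vec n v)"
    then have "(A *\<^sub>v vec n v) $ i = (\<Sum>j<n. A $$ (i, j) * v j)"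
      using A by (auto simp: scalar_prod_def lessThan_atLeast0 intro!: sum.cong)
    then show "(A *\<^sub>v vec n v) $ i = (k \<cdot>\<^sub>v vec n v) $ i"
      using i eq by simp
  qed (use A in auto)
  ultimately show ?thesis
    using A unfolding eigenvalue_def eigenvector_def by (intro exI[of _ "vec n v"]) auto
qed

text \<open>Evaluating \<open>u\<close> one step beyond either end of the path is what makes the two boundary rows
  instances of the interior recurrence: \<open>r (sin \<theta> - r sin 0) = r sin \<theta>\<close> is the value of \<open>u\<close> at \<open>- 1\<close>,
  so that \<open>v\<^sub>-\<^sub>1 = v\<^sub>0\<close>, and \<open>r u\<^sub>N = u\<^sub>N\<^sub>-\<^sub>1\<close> because \<open>sin (N \<theta>) = 0\<close> leaves only
  \<open>cos (N \<theta>) sin \<theta>\<close> in both.\<close>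

lemma lattice_mode:
  assumes pos: "0 < a" "0 < c" and N: "1 \<le> N" and \<theta>: "sin (real N * \<theta>) = 0" "sin \<theta> \<noteq> 0"
  shows "eigenvalue (lattice_mat a c N) (1 - a - c + 2 * sqrt (a * c) * cos \<theta>)"
proof -
  define r where "r = sqrt (a / c)"
  define s where "s = sqrt (a * c)"
  have r: "0 < r" and cr: "c * r = s" and sr: "s * r = a"
    using pos by (simp_all add: r_def s_def real_sqrt_mult real_sqrt_divide field_simps)
  define u where "u x = sin ((x + 1) * \<theta>) - r * sin (x * \<theta>)" for x :: real
  define v where "v i = r ^ i * u (real i)" for i
  have rec: "u (x - 1) + u (x + 1) = 2 * cos \<theta> * u x" for x
  proof -
    have double: "sin (\<phi> + \<theta>) = 2 * cos \<theta> * sin \<phi> - sin (\<phi> - \<theta>)" for \<phi>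
      by (simp add: sin_add sin_diff)
    have "u (x + 1) = 2 * cos \<theta> * u x - u (x - 1)"
      using double[of "(x + 1) * \<theta>"] double[of "x * \<theta>"] unfolding u_def
      by (simp add: distrib_right left_diff_distrib) (simp add: algebra_simps)
    then show ?thesis
      by simp
  qed
  have left_end: "u (- 1) = r * u 0"
    by (simp add: u_def)
  have right_end: "r * u (real N) = u (real N - 1)"
    using \<theta>(1) by (simp add: u_def distrib_right left_diff_distrib sin_add sin_diff)
  have up: "c * v (i + 1) = s * r ^ i * u (real i + 1)" for i
    using cr by (simp add: v_def ac_simps)
  have down: "a * (if 0 < i then v (i - 1) else v 0) = s * r ^ i * u (real i - 1)" for i
  proof (cases i)
    case 0
    then show ?thesis using left_end sr by (simp add: v_def)
  next
    case (Suc k)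
    then show ?thesis using sr by (simp add: v_def ac_simps)
  qed
  have last: "v (i + 1) = v i" if "i < N" "\<not> i + 1 < N" for i
  proof -
    have "N = i + 1"
      using that by simp
    then show ?thesis
      using right_end by (simp add: v_def)
  qed
  show ?thesis
  proof (rule eigenvalueI_sum[OF lattice_mat_carrier, where v = v])
    fix i assume i: "i < N"
    have "(\<Sum>j<N. lattice_mat a c N $$ (i, j) * v j)
        = v i + c * (v (i + 1) - v i) - a * (v i - (if 0 < i then v (i - 1) else v 0))"
      using last[OF i] i by (cases i) (auto simp: lattice_mat_row_sum)
    also have "\<dots> = (1 - a - c) * v i + s * r ^ i * (u (real i - 1) + u (real i + 1))"
      using up[of i] down[of i] by (simp add: algebra_simps split del: if_split)
    also have "\<dots> = (1 - a - c + 2 * sqrt (a * c) * cos \<theta>) * v i"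
      unfolding rec by (simp add: v_def s_def algebra_simps)
    finally show "(\<Sum>j<N. lattice_mat a c N $$ (i, j) * v j)
        = (1 - a - c + 2 * sqrt (a * c) * cos \<theta>) * v i" .
  next
    show "0 < N" "v 0 \<noteq> 0"
      using N \<theta> by (auto simp: v_def u_def)
  qed
qed

lemma eigenvalue_one_lattice_mat:
  assumes "1 \<le> N"
  shows "eigenvalue (lattice_mat a c N) 1"
  by (rule eigenvalueI_sum[OF lattice_mat_carrier, of _ _ _ "\<lambda>_. 1" _ 0])
    (use assms in \<open>auto simp: lattice_mat_row_sum[of _ _ _ _ "\<lambda>_. 1", simplified]\<close>)

lemma eigenvalue_lattice_eigval:
  assumes pos: "0 < a" "0 < c" and l: "l \<in> {1..N}"
  shows "eigenvalue (lattice_mat a c N) (lattice_eigval a c N l)"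
proof (cases "l = 1")
  case True
  then show ?thesis
    using l eigenvalue_one_lattice_mat by (simp add: lattice_eigval_def)
next
  case False
  define \<theta> where "\<theta> = (real l - 1) * pi / real N"
  have "real N * \<theta> = real (l - 1) * pi"
    using l by (simp add: \<theta>_def of_nat_diff)
  then have "sin (real N * \<theta>) = 0"
    by (simp only: sin_npi)
  moreover have "0 < \<theta>"
    using l False by (simp add: \<theta>_def)
  moreover have "\<theta> < pi"
    using l by (simp add: \<theta>_def divide_less_eq mult.commute)
  ultimately have "sin (real N * \<theta>) = 0" "sin \<theta> \<noteq> 0"
    using sin_gt_zero[of \<theta>] by auto
  then show ?thesis
    using lattice_mode[OF pos, of N \<theta>] l False by (simp add: lattice_eigval_def \<theta>_def)
qed

lemma lattice_eigval_less_one: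
  assumes "0 < a" "0 < c" "a \<noteq> c" "l \<noteq> 1"
  shows "lattice_eigval a c N l < 1"
proof -
  have "sqrt a \<noteq> sqrt c"
    using assms by simp
  then have "0 < (sqrt a - sqrt c)\<^sup>2"
    by simp
  then have "2 * sqrt (a * c) < a + c"
    using assms by (simp add: power2_diff real_sqrt_mult)
  moreover have "sqrt (a * c) * cos ((real l - 1) * pi / real N) \<le> sqrt (a * c)"
    using assms by (simp add: mult_left_le)
  ultimately show ?thesis
    using assms(4) unfolding lattice_eigval_def by simp
qed

lemma inj_on_lattice_eigval:
  assumes "0 < a" "0 < c" "a \<noteq> c"
  shows "inj_on (lattice_eigval a c N) {1..N}"
proof (rule inj_onI)
  fix k l assume kl: "k \<in> {1..N}" "l \<in> {1..N}"
    and eq: "lattice_eigval a c N k = lattice_eigval a c N l"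
  have one: "lattice_eigval a c N 1 = 1"
    by (simp add: lattice_eigval_def)
  show "k = l"
  proof (cases "k = 1 \<or> l = 1")
    case True
    then show ?thesis
      using eq one lattice_eigval_less_one[OF assms] by (metis less_irrefl)
  next
    case False
    then have "cos ((real k - 1) * pi / real N) = cos ((real l - 1) * pi / real N)"
      using eq assms by (simp add: lattice_eigval_def)
    then have "(real k - 1) * pi / real N = (real l - 1) * pi / real N"
      by (rule cos_inj_pi[rotated -1])
        (use kl in \<open>auto simp: divide_le_eq mult.commute[of _ pi]\<close>)
    then show ?thesis
      using kl by simp
  qed
qed

lemma char_poly_distinct_eigenvalues:
  fixes A :: "'a :: field mat"
  assumes A: "A \<in> carrier_mat n n"
    and S: "finite S" "card S = n" "\<And>x. x \<in> S \<Longrightarrow> eigenvalue A x"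
  shows "char_poly A = (\<Prod>x\<in>S. [:- x, 1:])"
proof (rule poly_eqI_degree_lead_coeff[of _ n _ S])
  have deg: "degree (\<Prod>x\<in>S. [:- x, 1:]) = n"
    using S by (subst degree_prod_eq_sum_degree) auto
  then show "degree (\<Prod>x\<in>S. [:- x, 1:]) \<le> n"
    by simp
  have "lead_coeff (\<Prod>x\<in>S. [:- x, 1:]) = 1"
    by (simp add: lead_coeff_prod)
  then show "coeff (char_poly A) n = coeff (\<Prod>x\<in>S. [:- x, 1:]) n"
    using degree_monic_char_poly[OF A] deg by simp
  show "degree (char_poly A) \<le> n" "n \<le> card S"
    using degree_monic_char_poly[OF A] S by auto
  show "poly (char_poly A) z = poly (\<Prod>x\<in>S. [:- x, 1:]) z" if "z \<in> S" for z
    using that S eigenvalue_root_char_poly[OF A] by (auto simp: poly_prod)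
qed

lemma char_poly_lattice_mat:
  assumes "0 < a" "0 < c" "a \<noteq> c"
  shows "char_poly (lattice_mat a c N) = (\<Prod>l = 1..N. [:- lattice_eigval a c N l, 1:])"
proof -
  let ?f = "lattice_eigval a c N"
  have inj: "inj_on ?f {1..N}"
    using assms by (rule inj_on_lattice_eigval)
  have "char_poly (lattice_mat a c N) = (\<Prod>x\<in>?f ` {1..N}. [:- x, 1:])"
    by (rule char_poly_distinct_eigenvalues[OF lattice_mat_carrier])
      (use assms eigenvalue_lattice_eigval card_image[OF inj] in auto)
  then show ?thesis
    by (simp only: prod.reindex[OF inj] o_def)
qed

lemma spectrum_lattice_mat:
  assumes "0 < a" "0 < c" "a \<noteq> c"
  shows "spectrum (map_mat complex_of_real (lattice_mat a c N))
    = {complex_of_real (lattice_eigval a c N l) | l. l \<in> {1..N}}"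
proof -
  interpret map_poly_hom: map_poly_comm_ring_hom complex_of_real ..
  have "char_poly (map_mat complex_of_real (lattice_mat a c N))
      = (\<Prod>l = 1..N. [:- complex_of_real (lattice_eigval a c N l), 1:])"
    using of_real_hom.char_poly_hom[OF lattice_mat_carrier, where ?'a = complex]
    by (simp add: char_poly_lattice_mat[OF assms] map_poly_hom.hom_prod map_poly_pCons)
  then have "poly (char_poly (map_mat complex_of_real (lattice_mat a c N))) z = 0
      \<longleftrightarrow> (\<exists>l\<in>{1..N}. z = complex_of_real (lattice_eigval a c N l))" for z
    by (simp add: poly_prod)
  then show ?thesis
    by (subst spectrum_root_char_poly[of _ N]) auto
qed

section \<open>Stochasticity, irreducibility and primitivity\<close>

lemma lattice_mat_nonneg:
  assumes "0 < a" "0 < c" "a + c \<le> 1" "i < N" "j < N"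
  shows "0 \<le> lattice_mat a c N $$ (i, j)"
  using assms by (auto simp: lattice_mat_def)

lemma stochastic_lattice_mat:
  assumes "0 < a" "0 < c" "a + c \<le> 1"
  shows "stochastic_mat (lattice_mat a c N)"
  using lattice_mat_nonneg[OF assms] lattice_mat_row_sum[of _ N a c "\<lambda>_. 1"]
  by (auto simp: stochastic_mat_def)

lemma pow_mat_nonneg:
  fixes W :: "'a :: linordered_semidom mat"
  assumes W: "W \<in> carrier_mat n n" "\<And>i j. i < n \<Longrightarrow> j < n \<Longrightarrow> 0 \<le> W $$ (i, j)"
    and "i < n" "j < n"
  shows "0 \<le> (W ^\<^sub>m k) $$ (i, j)"
  using \<open>j < n\<close>
proof (induction k arbitrary: j)
  case 0
  then show ?case
    using W \<open>i < n\<close> by simp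
next
  case (Suc k)
  have "(W ^\<^sub>m Suc k) $$ (i, j) = (\<Sum>l<n. (W ^\<^sub>m k) $$ (i, l) * W $$ (l, j))"
    using W \<open>i < n\<close> Suc.prems pow_carrier_mat[OF W(1), of k]
    by (auto simp: scalar_prod_def lessThan_atLeast0 intro!: sum.cong)
  also have "0 \<le> \<dots>"
    using Suc W by (intro sum_nonneg mult_nonneg_nonneg) auto
  finally show ?case .
qed

lemma pow_mat_Suc_pos:
  fixes W :: "'a :: linordered_semidom mat"
  assumes W: "W \<in> carrier_mat n n" "\<And>i j. i < n \<Longrightarrow> j < n \<Longrightarrow> 0 \<le> W $$ (i, j)"
    and "i < n" "l < n" "j < n"
    and pos: "0 < (W ^\<^sub>m k) $$ (i, l)" "0 < W $$ (l, j)"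
  shows "0 < (W ^\<^sub>m Suc k) $$ (i, j)"
proof -
  have "0 < (\<Sum>l<n. (W ^\<^sub>m k) $$ (i, l) * W $$ (l, j))"
    using assms pow_mat_nonneg[OF W]
    by (intro sum_pos2[of _ l] mult_pos_pos mult_nonneg_nonneg) auto
  also have "\<dots> = (W ^\<^sub>m Suc k) $$ (i, j)"
    using W \<open>i < n\<close> \<open>j < n\<close> pow_carrier_mat[OF W(1), of k]
    by (auto simp: scalar_prod_def lessThan_atLeast0 intro!: sum.cong)
  finally show ?thesis .
qed

text \<open>The interior diagonal entry \<open>1 - a - c\<close> may vanish, so a walk can be sure of
  being able to waste steps only at an end of the path; at the first node the idling probability
  is at least \<open>1 - c > 0\<close>. A walk
  from \<open>s\<close> to \<open>t\<close> of length \<open>2 N\<close> therefore goes down to the first node, idles there for the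
  \<open>2 N - s - t\<close> spare steps, and goes up.\<close>

lemma pow_lattice_mat_pos:
  assumes ac: "0 < a" "0 < c" "a + c \<le> 1" and st: "s < N" "t < N"
  shows "0 < (lattice_mat a c N ^\<^sub>m (2 * N)) $$ (s, t)"
proof -
  let ?W = "lattice_mat a c N"
  note step = pow_mat_Suc_pos[OF lattice_mat_carrier lattice_mat_nonneg[OF ac] \<open>s < N\<close>]
  have down: "0 < (?W ^\<^sub>m k) $$ (s, s - k)" if "k \<le> s" for k
    using that
  proof (induction k)
    case 0
    then show ?case using st by simp
  next
    case (Suc k)
    then show ?case
      using st ac by (intro step[of "s - k"]) (auto simp: lattice_mat_def)
  qed
  have idle: "0 < (?W ^\<^sub>m (s + k)) $$ (s, 0)" for k
  proof (induction k)
    case 0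
    then show ?case using down[of s] by simp
  next
    case (Suc k)
    then show ?case
      using st ac by (simp only: add_Suc_right, intro step[of 0]) (auto simp: lattice_mat_def)
  qed
  have up: "0 < (?W ^\<^sub>m (s + (2 * N - s - t) + k)) $$ (s, k)" if "k < N" for k
    using that
  proof (induction k)
    case 0
    then show ?case using idle by simp
  next
    case (Suc k)
    then show ?case
      using st ac by (simp only: add_Suc_right, intro step[of k]) (auto simp: lattice_mat_def)
  qed
  have "s + (2 * N - s - t) + t = 2 * N"
    using st by simp
  then show ?thesis
    using up[OF \<open>t < N\<close>] by simp
qed

lemma irreducible_lattice_mat:
  assumes "0 < a" "0 < c" "a + c \<le> 1"
  shows "irreducible_mat (lattice_mat a c N)"
  using pow_lattice_mat_pos[OF assms] unfolding irreducible_mat_def by auto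

lemma primitive_lattice_mat:
  assumes "0 < a" "0 < c" "a + c \<le> 1" "1 \<le> N"
  shows "primitive_mat (lattice_mat a c N)"
  unfolding primitive_mat_def
  using pow_lattice_mat_pos[OF assms(1-3)] assms(4) by (intro exI[of _ "2 * N"]) simp

section \<open>The left Perron vector\<close>

text \<open>Nothing flows in from the left of the first node, so the first column of \<open>p W = p\<close> makes the net
  flow across the first edge vanish, and each further column passes this on to the next edge.\<close>

lemma lattice_stationary_iff:
  assumes "0 < a"
  shows "(\<forall>j<N. (\<Sum>i<N. p i * lattice_mat a c N $$ (i, j)) = p j)
    \<longleftrightarrow> (\<forall>j<N. p j = p 0 * (c / a) ^ j)"
proof
  assume stat: "\<forall>j<N. (\<Sum>i<N. p i * lattice_mat a c N $$ (i, j)) = p j"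
  have balance: "a * p (j + 1) = c * p j" if "j + 1 < N" for j
    using that
  proof (induction j)
    case 0
    then show ?case
      using stat[rule_format, of 0] by (simp add: lattice_mat_column_sum)
  next
    case (Suc j)
    then show ?case
      using stat[rule_format, of "Suc j"] by (simp add: lattice_mat_column_sum)
  qed
  have "p j = p 0 * (c / a) ^ j" if "j < N" for j
    using that
  proof (induction j)
    case (Suc j)
    then show ?case
      using balance[of j] assms by (simp add: nonzero_eq_divide_eq mult.commute)
  qed simp
  then show "\<forall>j<N. p j = p 0 * (c / a) ^ j"
    by blast
next
  assume geom: "\<forall>j<N. p j = p 0 * (c / a) ^ j"
  have balance: "c * p j = a * p (j + 1)" if "j + 1 < N" for j
    using geom[rule_format, of j] geom[rule_format, of "j + 1"] that assms by simp
  show "\<forall>j<N. (\<Sum>i<N. p i * lattice_mat a c N $$ (i, j)) = p j"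
    using balance balance[of "j - 1" for j] by (auto simp: lattice_mat_column_sum)
qed

lemma left_perron_vector_lattice_mat_iff:
  assumes ac: "0 < a" "0 < c" "a \<noteq> c" "a + c \<le> 1" and N: "1 \<le> N"
  shows "left_perron_vector (lattice_mat a c N) p \<longleftrightarrow>
    p = mat 1 N (\<lambda>(_, j). (1 - c / a) / (1 - (c / a) ^ N) * (c / a) ^ j)"
proof -
  define q where "q = c / a"
  have q: "0 < q" "q \<noteq> 1"
    using ac by (auto simp: q_def)
  have geometric_sum: "(\<Sum>j<N. q ^ j) = (1 - q ^ N) / (1 - q)"
    using q sum_gp_strict[of q N] by simp
  have pos_sum: "0 < (\<Sum>j<N. q ^ j)"
    using q N by (intro sum_pos) (auto simp: lessThan_empty_iff)
  have fixed_iff: "p * lattice_mat a c N = p \<longleftrightarrow>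
      (\<forall>j<N. p $$ (0, j) = p $$ (0, 0) * q ^ j)" if "p \<in> carrier_mat 1 N"
  proof -
    have "p * lattice_mat a c N = p \<longleftrightarrow>
        (\<forall>j<N. (\<Sum>i<N. p $$ (0, i) * lattice_mat a c N $$ (i, j)) = p $$ (0, j))"
      using that by (auto simp: mat_eq_iff scalar_prod_def lessThan_atLeast0)
    then show ?thesis
      unfolding q_def by (simp add: lattice_stationary_iff[OF ac(1)])
  qed
  have "left_perron_vector (lattice_mat a c N) p \<longleftrightarrow>
      p \<in> carrier_mat 1 N \<and> (\<forall>j<N. p $$ (0, j) = p $$ (0, 0) * q ^ j) \<and>
      (\<forall>j<N. 0 < p $$ (0, j)) \<and> (\<Sum>j<N. p $$ (0, j)) = 1"
    unfolding left_perron_vector_def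
    using fixed_iff stochastic_lattice_mat irreducible_lattice_mat primitive_lattice_mat ac N
    by auto
  also have "\<dots> \<longleftrightarrow> p \<in> carrier_mat 1 N \<and> (\<forall>j<N. p $$ (0, j) = 1 / (\<Sum>j<N. q ^ j) * q ^ j)"
    (is "?L \<longleftrightarrow> ?R")
  proof
    assume L: ?L
    have geom: "p $$ (0, j) = p $$ (0, 0) * q ^ j" if "j < N" for j
      using L that by blast
    have "(\<Sum>j<N. p $$ (0, j)) = (\<Sum>j<N. p $$ (0, 0) * q ^ j)"
      by (rule sum.cong[OF refl], rule geom) simp
    then have "p $$ (0, 0) * (\<Sum>j<N. q ^ j) = 1"
      using L by (simp only: sum_distrib_left)
    then have p0: "p $$ (0, 0) = 1 / (\<Sum>j<N. q ^ j)"
      using pos_sum by (simp add: field_simps)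
    show ?R
      using L unfolding p0 by blast
  next
    assume R: ?R
    then have "p $$ (0, 0) = 1 / (\<Sum>j<N. q ^ j)"
      using N by auto
    moreover have "(\<Sum>j<N. p $$ (0, j)) = 1"
      using R pos_sum by (simp add: sum_divide_distrib[symmetric])
    ultimately show ?L
      using R pos_sum q by simp
  qed
  also have "\<dots> \<longleftrightarrow> p = mat 1 N (\<lambda>(_, j). (1 - q) / (1 - q ^ N) * q ^ j)"
    unfolding geometric_sum by (auto simp: mat_eq_iff)
  finally show ?thesis
    unfolding q_def .
qed

theorem lemma1:
  fixes a c :: real and N :: nat
  assumes "0 < a" and "0 < c" and "a \<noteq> c" and "a + c \<le> 1" and "1 \<le> N"
  shows "spectrum (map_mat complex_of_real (lattice_mat a c N))
           = {complex_of_real (lattice_eigval a c N l) | l. l \<in> {1..N}}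
       \<and> char_poly (lattice_mat a c N) = (\<Prod>l = 1..N. [:- lattice_eigval a c N l, 1:])
       \<and> (\<forall>p. left_perron_vector (lattice_mat a c N) p \<longleftrightarrow>
             p = mat 1 N (\<lambda>(_, j). (1 - c / a) / (1 - (c / a) ^ N) * (c / a) ^ j))"
  using spectrum_lattice_mat[OF assms(1-3)] char_poly_lattice_mat[OF assms(1-3)]
    left_perron_vector_lattice_mat_iff[OF assms]
  by blast

end
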